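(* Let $r\ge 3$ be an integer. Then $$P_{2^r}(t)\equiv(1-t^2)^{2^{r-2}}+2^{r-1}\left(t+t^2+t^{2^{r-1}+1}+t^{2^{r-1}+2}\right)\pmod{2^r}$$ and $$P_{2^r}(t)\equiv(1-t^2)^{2^{r-2}}\left(1+2^{r-1}t(t+1)\right)\pmod{2^r}.$$ On the other hand, $$P_2(t)=t+1$$ and $$P_4(t)\equiv(1+2t)(1-t^2)\pmod 4.$$
   Context: For an integer $n\ge 1$, $P_n(t)=\prod_{k=0}^{n-1}(1+kt)\in\mathbb{Z}[t]$. For polynomials $A(t),B(t)\in\mathbb{Z}[t]$, $A(t)\equiv B(t)\pmod N$ means that all coefficients of $A(t)-B(t)$ are divisible by $N$. *)

theory Defs
  imports "HOL-Computational_Algebra.Polynomial"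
begin

abbreviation t :: "int poly" where
  "t \<equiv> [:0, 1:]"

definition P :: "nat \<Rightarrow> int poly" where
  "P n = (\<Prod>k<n. 1 + of_nat k * t)"

(* The library congruence cong needs a class with division with remainder,
   which int poly does not belong to. *)
definition poly_cong :: "int poly \<Rightarrow> int poly \<Rightarrow> int \<Rightarrow> bool" where
  "poly_cong A B N \<longleftrightarrow> (\<forall>i. N dvd coeff (A - B) i)"

end

theory Submission
  imports Defs
begin

text \<open>
  Two facts carry the proof, both of them instances of the principle that squaring
  doubles a modulus: if \<open>N\<close> is even and \<open>a \<equiv> b\<close> modulo \<open>N\<close>, then \<open>a\<^sup>2 \<equiv> b\<^sup>2\<close>
  modulo \<open>2N\<close>, because \<open>a\<^sup>2 - b\<^sup>2 = (a - b)(a + b)\<close> and \<open>a + b\<close> is even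
  (\<open>square_doubles_modulus\<close>).

  The first fact is \<open>P (2N) \<equiv> P N ^ 2\<close> modulo \<open>2N\<close> whenever \<open>4\<close> divides \<open>N\<close>
  (\<open>P_double\<close>). The upper half of the factors of \<open>P (2N)\<close> is the lower half with \<open>k\<close>
  replaced by \<open>k + N\<close>, and this shift is invisible modulo \<open>2N\<close> on each block of four
  consecutive factors: a product of four terms in arithmetic progression is a square
  minus a term that the shift does not touch, so the principle applies to it.

  The second fact is that only \<open>P N\<close> modulo \<open>N\<close> matters for \<open>P N ^ 2\<close> modulo \<open>2N\<close>. Hence
  a congruence for \<open>P (2 ^ r)\<close> modulo \<open>2 ^ r\<close> may simply be squared to give one for
  \<open>P (2 ^ Suc r)\<close>. From \<open>P 4 \<equiv> (1 + 2t)(1 - t\<^sup>2)\<close> modulo \<open>4\<close>, one squaring gives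
  the factored form for \<open>r = 3\<close>, and further squarings reproduce it for all larger \<open>r\<close>.
  The expanded form follows, because the term carrying the coefficient \<open>2 ^ (r - 1)\<close> only
  matters modulo \<open>2\<close>, where \<open>(1 - t\<^sup>2) ^ (2 ^ m) \<equiv> 1 + t ^ (2 ^ (m + 1))\<close>.
\<close>

section \<open>Congruences in a commutative ring\<close>

lemma dvd_diff_trans:
  fixes d :: "'a::comm_ring_1"
  assumes "d dvd a - b" "d dvd b - c"
  shows "d dvd a - c"
proof -
  have "a - c = (a - b) + (b - c)" by simp
  then show ?thesis using assms by (metis dvd_add)
qed

lemma dvd_diff_mult:
  fixes d :: "'a::comm_ring_1"
  assumes "d dvd a - b" "d dvd c - e"
  shows "d dvd a * c - b * e"
proof -
  have "a * c - b * e = (a - b) * c + b * (c - e)" by (simp add: algebra_simps)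
  then show ?thesis using assms by (metis dvd_add dvd_mult dvd_mult2)
qed

lemma square_doubles_modulus:
  fixes N :: "'a::comm_ring_1"
  assumes "2 dvd N" "N dvd a - b"
  shows "2 * N dvd a ^ 2 - b ^ 2"
proof -
  have "2 dvd (a - b) + 2 * b" using assms by (meson dvd_add dvd_trans dvd_triv_left)
  then have "2 dvd a + b" by (simp add: algebra_simps)
  moreover have "a ^ 2 - b ^ 2 = (a + b) * (a - b)"
    by (simp add: power2_eq_square algebra_simps)
  ultimately show ?thesis using assms(2) by (simp add: mult_dvd_mono)
qed

section \<open>Doubling the number of factors\<close>

text \<open>
  With \<open>w = u\<^sup>2 + 3uy + y\<^sup>2\<close> one has \<open>u (u + y) (u + 2y) (u + 3y) = w\<^sup>2 - y\<^sup>4\<close>, and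
  shifting \<open>u\<close> by a multiple of \<open>N\<close> changes \<open>w\<close> by a multiple of \<open>N\<close>.
\<close>

lemma four_term_product_shift:
  fixes N :: "'a::comm_ring_1"
  assumes "2 dvd N" "N dvd v - u"
  shows "2 * N dvd v * (v + y) * (v + 2 * y) * (v + 3 * y)
                  - u * (u + y) * (u + 2 * y) * (u + 3 * y)"
proof -
  define w where "w = (\<lambda>u::'a. u ^ 2 + 3 * u * y + y ^ 2)"
  have w: "x * (x + y) * (x + 2 * y) * (x + 3 * y) = w x ^ 2 - y ^ 4" for x
    by (simp add: w_def power2_eq_square power4_eq_xxxx algebra_simps)
  have "w v - w u = (v - u) * (v + u + 3 * y)"
    by (simp add: w_def power2_eq_square algebra_simps)
  then have "N dvd w v - w u" using assms(2) by simp
  from square_doubles_modulus[OF assms(1) this] show ?thesis unfolding w by simp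
qed

lemma blocks_of_four_shift:
  fixes y :: "'a::comm_ring_1"
  assumes "even N"
  shows "2 * of_nat N dvd (\<Prod>k<4 * m. 1 + of_nat (N + k) * y) - (\<Prod>k<4 * m. 1 + of_nat k * y)"
proof (induction m)
  case 0
  then show ?case by simp
next
  case (Suc m)
  let ?u = "1 + of_nat (4 * m) * y" and ?v = "1 + of_nat (N + 4 * m) * y"
  let ?q = "\<lambda>u. u * (u + y) * (u + 2 * y) * (u + 3 * y)"
  have 4: "4 * Suc m = Suc (Suc (Suc (Suc (4 * m))))" by simp
  have "(\<Prod>k<4 * Suc m. 1 + of_nat k * y) = (\<Prod>k<4 * m. 1 + of_nat k * y) * ?q ?u"
    unfolding 4 by (simp add: algebra_simps)
  moreover have "(\<Prod>k<4 * Suc m. 1 + of_nat (N + k) * y) =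
      (\<Prod>k<4 * m. 1 + of_nat (N + k) * y) * ?q ?v"
    unfolding 4 by (simp add: algebra_simps)
  moreover have "2 * of_nat N dvd ?q ?v - ?q ?u"
  proof (rule four_term_product_shift)
    show "(2::'a) dvd of_nat N" using assms by (auto elim!: evenE)
    have "?v - ?u = of_nat N * y" by (simp add: algebra_simps)
    then show "of_nat N dvd ?v - ?u" by simp
  qed
  ultimately show ?case using dvd_diff_mult[OF Suc.IH] by metis
qed

lemma P_double:
  assumes "4 dvd N"
  shows "2 * of_nat N dvd P (2 * N) - P N ^ 2"
proof -
  obtain m where m: "N = 4 * m" using assms by (elim dvdE)
  have "(\<Prod>k<n + j. 1 + of_nat k * t) = P n * (\<Prod>k<j. 1 + of_nat (n + k) * t)" for n j
    unfolding P_def by (induction j) (simp_all add: mult.assoc)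
  from this[of N N] have split: "P (2 * N) = P N * (\<Prod>k<N. 1 + of_nat (N + k) * t)"
    by (simp add: P_def mult_2)
  have "2 * of_nat N dvd (\<Prod>k<N. 1 + of_nat (N + k) * t) - P N"
    using blocks_of_four_shift[of N t m] m unfolding P_def by simp
  then have "2 * of_nat N dvd P N * ((\<Prod>k<N. 1 + of_nat (N + k) * t) - P N)" by simp
  then show ?thesis unfolding split by (simp add: power2_eq_square algebra_simps)
qed

lemma P_power_of_2_square:
  assumes "r \<ge> 2" "2 ^ r dvd P (2 ^ r) - A"
  shows "2 ^ Suc r dvd P (2 ^ Suc r) - A ^ 2"
proof (rule dvd_diff_trans)
  have "(4::nat) dvd 2 ^ r" using le_imp_power_dvd[OF assms(1), of "2::nat"] by simp
  from P_double[OF this] show "2 ^ Suc r dvd P (2 ^ Suc r) - P (2 ^ r) ^ 2" by simp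
  have "(2::int poly) dvd 2 ^ r" using assms(1) by (simp add: dvd_power)
  from square_doubles_modulus[OF this assms(2)]
  show "2 ^ Suc r dvd P (2 ^ r) ^ 2 - A ^ 2" by simp
qed

section \<open>The factored and the expanded form\<close>

lemma poly_cong_iff_dvd: "poly_cong A B (2 ^ r) \<longleftrightarrow> 2 ^ r dvd A - B"
proof -
  have "(2::int poly) ^ r = [:2 ^ r:]" using of_int_poly[of "2 ^ r", where 'a=int] by simp
  then show ?thesis by (simp add: poly_cong_def const_poly_dvd_iff)
qed

lemma P_4_cong: "2 ^ 2 dvd P 4 - (1 + 2 * t) * (1 - t ^ 2)"
proof -
  have "P 4 = (1 + t) * (1 + 2 * t) * (1 + 3 * t)"
    unfolding P_def by (simp add: numeral_eq_Suc lessThan_Suc mult.commute)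
  then have "P 4 - (1 + 2 * t) * (1 - t ^ 2) = 2 ^ 2 * (t * (1 + t) * (1 + 2 * t))"
    by algebra
  then show ?thesis by (metis dvd_triv_left)
qed

text \<open>
  Squaring \<open>1 + 2 ^ (r - 1) * s\<close> gives \<open>1 + 2 ^ r * s\<close> up to \<open>2 ^ (2 * r - 2) * s\<^sup>2\<close>, which
  vanishes modulo \<open>2 ^ Suc r\<close> as soon as \<open>r \<ge> 3\<close>. At \<open>r = 2\<close> the square of \<open>1 + 2t\<close> is
  already \<open>1 + 4t(t + 1)\<close>, which starts the induction at \<open>r = 3\<close>.
\<close>

lemma P_power_of_2_factored:
  assumes "r \<ge> 3"
  shows "2 ^ r dvd P (2 ^ r) - (1 - t ^ 2) ^ (2 ^ (r - 2)) * (1 + 2 ^ (r - 1) * t * (t + 1))"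
  using assms
proof (induction r rule: nat_induct_at_least)
  case base
  have "2 ^ 2 dvd P (2 ^ 2) - (1 + 2 * t) * (1 - t ^ 2)" using P_4_cong by simp
  from P_power_of_2_square[OF order_refl this]
  have "2 ^ 3 dvd P (2 ^ 3) - ((1 + 2 * t) * (1 - t ^ 2)) ^ 2" by (simp add: numeral_eq_Suc)
  moreover have "((1 + 2 * t) * (1 - t ^ 2)) ^ 2 = (1 - t ^ 2) ^ 2 * (1 + 2 ^ 2 * t * (t + 1))"
    by algebra
  ultimately show ?case by simp
next
  case (Suc r)
  define c :: "int poly" where "c = 2 ^ (r - 1)"
  define a where "a = (1 - t ^ 2) ^ (2 ^ (r - 2))"
  define s where "s = t * (t + 1)"
  have "Suc r - 2 = Suc (r - 2)" using Suc.hyps by simp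
  then have a2: "(1 - t ^ 2) ^ (2 ^ (Suc r - 2)) = a ^ 2"
    by (simp add: a_def power_mult[symmetric] mult.commute)
  have c2: "2 ^ (Suc r - 1) = 2 * c" using Suc.hyps by (simp add: c_def power_eq_if)
  have "2 ^ Suc r dvd P (2 ^ Suc r) - (a * (1 + c * s)) ^ 2"
    using P_power_of_2_square[of r] Suc by (simp add: a_def c_def s_def mult.assoc)
  moreover have "2 ^ Suc r dvd (a * (1 + c * s)) ^ 2 - a ^ 2 * (1 + 2 * c * s)"
  proof -
    have "Suc r \<le> 2 * (r - 1)" using Suc.hyps by simp
    then have "2 ^ Suc r dvd c ^ 2"
      by (simp add: c_def power_mult[symmetric] mult.commute le_imp_power_dvd del: power_Suc)
    moreover have "(a * (1 + c * s)) ^ 2 - a ^ 2 * (1 + 2 * c * s) = c ^ 2 * (a ^ 2 * s ^ 2)"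
      by algebra
    ultimately show ?thesis by (metis dvd_mult2)
  qed
  ultimately show ?case
    unfolding a2 c2 by (simp add: s_def mult.assoc dvd_diff_trans del: power_Suc)
qed

lemma one_minus_square_power_mod_2:
  fixes y :: "'a::comm_ring_1"
  shows "2 dvd (1 - y ^ 2) ^ (2 ^ m) - (1 + y ^ (2 ^ Suc m))"
proof (induction m)
  case 0
  have "(1 - y ^ 2) ^ (2 ^ 0) - (1 + y ^ (2 ^ Suc 0)) = 2 * (- (y ^ 2))" by simp
  then show ?case by (metis dvd_triv_left)
next
  case (Suc m)
  define a b where "a = (1 - y ^ 2) ^ (2 ^ m)" and "b = y ^ (2 ^ Suc m)"
  have "2 dvd a - (1 + b)" using Suc by (simp add: a_def b_def)
  then have "2 dvd a ^ 2 - (1 + b) ^ 2"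
    using dvd_diff_mult[of 2 a "1 + b" a "1 + b"] by (simp add: power2_eq_square)
  moreover have "(1 + b) ^ 2 - (1 + b ^ 2) = 2 * b"
    by (simp add: power2_eq_square algebra_simps)
  then have "2 dvd (1 + b) ^ 2 - (1 + b ^ 2)" by simp
  ultimately have "2 dvd a ^ 2 - (1 + b ^ 2)" by (rule dvd_diff_trans)
  then show ?case by (simp add: a_def b_def power_mult[symmetric] mult.commute)
qed

lemma factored_form_cong_expanded_form:
  assumes "r \<ge> 2"
  shows "2 ^ r dvd (1 - t ^ 2) ^ (2 ^ (r - 2)) * (1 + 2 ^ (r - 1) * t * (t + 1))
           - ((1 - t ^ 2) ^ (2 ^ (r - 2))
              + 2 ^ (r - 1) * (t + t ^ 2 + t ^ (2 ^ (r - 1) + 1) + t ^ (2 ^ (r - 1) + 2)))"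
proof -
  define c :: "int poly" where "c = 2 ^ (r - 1)"
  define a b where "a = (1 - t ^ 2) ^ (2 ^ (r - 2))" and "b = t ^ (2 ^ (r - 1))"
  have "Suc (r - 2) = r - 1" using assms by simp
  then have "2 dvd a - (1 + b)"
    using one_minus_square_power_mod_2[of t "r - 2"] by (simp add: a_def b_def del: power_Suc)
  then have "2 * c dvd (a - (1 + b)) * (c * (t * (t + 1)))"
    by (intro mult_dvd_mono dvd_triv_left)
  moreover have "(a - (1 + b)) * (c * (t * (t + 1)))
      = a * (1 + c * t * (t + 1)) - (a + c * (t + t ^ 2 + b * t + b * t ^ 2))" by algebra
  moreover have "2 ^ r = 2 * c" using assms by (simp add: c_def power_eq_if)
  ultimately show ?thesis
    unfolding a_def[symmetric] c_def[symmetric] power_add b_def[symmetric] by simp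
qed


theorem theorem2p3:
  shows "(\<forall>r::nat. r \<ge> 3 \<longrightarrow>
            poly_cong (P (2 ^ r))
              ((1 - t ^ 2) ^ (2 ^ (r - 2))
                + 2 ^ (r - 1) * (t + t ^ 2 + t ^ (2 ^ (r - 1) + 1) + t ^ (2 ^ (r - 1) + 2)))
              (2 ^ r)
          \<and> poly_cong (P (2 ^ r))
              ((1 - t ^ 2) ^ (2 ^ (r - 2)) * (1 + 2 ^ (r - 1) * t * (t + 1)))
              (2 ^ r))
       \<and> P 2 = t + 1
       \<and> poly_cong (P 4) ((1 + 2 * t) * (1 - t ^ 2)) 4"
proof (intro conjI allI impI)
  fix r :: nat
  assume r: "r \<ge> 3"
  show "poly_cong (P (2 ^ r)) ((1 - t ^ 2) ^ (2 ^ (r - 2)) * (1 + 2 ^ (r - 1) * t * (t + 1))) (2 ^ r)"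
    unfolding poly_cong_iff_dvd by (rule P_power_of_2_factored[OF r])
  show "poly_cong (P (2 ^ r))
          ((1 - t ^ 2) ^ (2 ^ (r - 2))
            + 2 ^ (r - 1) * (t + t ^ 2 + t ^ (2 ^ (r - 1) + 1) + t ^ (2 ^ (r - 1) + 2)))
          (2 ^ r)"
    unfolding poly_cong_iff_dvd
    by (rule dvd_diff_trans[OF P_power_of_2_factored[OF r] factored_form_cong_expanded_form])
      (use r in simp)
next
  show "P 2 = t + 1"
    unfolding P_def by (simp add: numeral_eq_Suc lessThan_Suc)
next
  show "poly_cong (P 4) ((1 + 2 * t) * (1 - t ^ 2)) 4"
    using P_4_cong poly_cong_iff_dvd[of _ _ 2] by simp
qed

end
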